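(* Let $X=\{-1,+1\}$, let $T(s)=X$ for both $s\in X$, and set $\psi(s,t)=t$. For $\beta\ge0$ consider the energy $$\mathcal{E}_\beta(\gamma)=\frac\beta2\Bigl(\int_{X^2}\psi\,d\gamma\Bigr)^2,\qquad\gamma\in\mathcal{M}(X^2).$$ Then the critical inverse temperature is $\beta_c=1$, and the nonlinear equilibrium pairs are as follows. (i) If $0\le\beta\le1$, the unique equilibrium pair is $\mu_0(s)=\frac12$, $Q_0(s,t)=\frac12$. (ii) If $\beta>1$, there are exactly two equilibrium pairs. Let $m_\beta\in(0,1)$ be the unique positive solution of $m_\beta=\tanh(\beta m_\beta)$, and for $\sigma\in\{-1,+1\}$ let $p_{\sigma m_\beta}(t)=\frac{1+\sigma m_\beta t}{2}$. The two equilibrium pairs and their two-coordinate distributions are $$\mu_\beta^\sigma(s)=p_{\sigma m_\beta}(s),\qquad Q_\beta^\sigma(s,t)=p_{\sigma m_\beta}(t),\qquad\gamma_\beta^\sigma(s,t)=p_{\sigma m_\beta}(s)p_{\sigma m_\beta}(t),\qquad\sigma\in\{-1,+1\}.$$ The nonlinear pressure is $$\Pi_{\mathrm{top}}^{\mathcal{E}_\beta}(T)=\begin{cases}\log2,&0\le\beta\le1,\\ \log\bigl(2\cosh(\beta m_\beta)\bigr)-\frac\beta2m_\beta^2,&\beta>1.\end{cases}$$ In particular, the model undergoes a continuous symmetry-breaking transition at $\beta=1$ (that is, with $m_\beta\to0$ as $\beta\to1^+$) from a unique equilibrium pair to two distinct equilibrium pairs.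
   Context: Finite-state conventions. Let $X$ be a finite set with the discrete metric, $T$ a map assigning to each $i\in X$ a nonempty subset $T(i)\subset X$, and $\Gamma_T=\{(i,j):j\in T(i)\}$. $\mathcal{M}(\Gamma_T)$ is the set of probability vectors on $\Gamma_T$, and $\mathcal{E}:\mathcal{M}(\Gamma_T)\to\mathbb{R}$ is continuous. A stationary transition pair $(\mu,Q)$ consists of a stochastic matrix $Q=(Q(i,j))$ with $Q(i,j)=0$ for $j\notin T(i)$ and a probability vector $\mu$ with $\sum_i\mu(i)Q(i,j)=\mu(j)$. Its two-coordinate distribution is $\gamma_{\mu,Q}(i,j)=\mu(i)Q(i,j)$, and $h_\mu(Q)$ is the entropy rate of the stationary Markov chain, $h_\mu(Q)=-\sum_{i,j}\mu(i)Q(i,j)\log Q(i,j)$ ($0\log0=0$; natural logarithms). A nonlinear equilibrium pair is a stationary transition pair maximizing $h_\mu(Q)+\mathcal{E}(\gamma_{\mu,Q})$ among all stationary transition pairs. Rows $Q(i,\cdot)$ with $\mu(i)=0$ are immaterial (kernels agreeing $\mu$-a.e. are identified). Nonlinear pressure: for a path $\boldsymbol{x}=(x_0,\dots,x_n)$ with $x_{j+1}\in T(x_j)$, let $L_n(\boldsymbol{x})=\frac1n\sum_{j=0}^{n-1}\delta_{(x_j,x_{j+1})}$; then $\Pi_{\mathrm{top}}^{\mathcal{E}}(T)=\lim_{n\to\infty}\frac1n\log\sum_{\boldsymbol{x}}\exp(n\mathcal{E}(L_n(\boldsymbol{x})))$, the sum over all such paths. The critical inverse temperature is the value of $\beta$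 separating the regime with a unique equilibrium pair from the regime with several. *)

theory Defs
  imports Complex_Main
begin

(* The finite state space is a carrier set X.  Vectors and matrices over X are functions on the
   ambient type; only their values on X matter.  A vector on the set of allowed transitions is a
   function on pairs, extended by 0 off that set. *)

definition stationary_pair ::
  "'a set \<Rightarrow> ('a \<Rightarrow> 'a set) \<Rightarrow> ('a \<Rightarrow> real) \<Rightarrow> ('a \<Rightarrow> 'a \<Rightarrow> real) \<Rightarrow> bool" where
  "stationary_pair X T \<mu> Q \<longleftrightarrow>
     (\<forall>i\<in>X. \<forall>j\<in>X. 0 \<le> Q i j) \<and>
     (\<forall>i\<in>X. (\<Sum>j\<in>X. Q i j) = 1) \<and>
     (\<forall>i\<in>X. \<forall>j\<in>X. j \<notin> T i \<longrightarrow> Q i j = 0) \<and>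
     (\<forall>i\<in>X. 0 \<le> \<mu> i) \<and>
     (\<Sum>i\<in>X. \<mu> i) = 1 \<and>
     (\<forall>j\<in>X. (\<Sum>i\<in>X. \<mu> i * Q i j) = \<mu> j)"

definition two_coord ::
  "'a set \<Rightarrow> ('a \<Rightarrow> real) \<Rightarrow> ('a \<Rightarrow> 'a \<Rightarrow> real) \<Rightarrow> 'a \<times> 'a \<Rightarrow> real" where
  "two_coord X \<mu> Q = (\<lambda>(i, j). if i \<in> X \<and> j \<in> X then \<mu> i * Q i j else 0)"

(* The convention 0 log 0 = 0 holds because the logarithm is multiplied by Q i j. *)
definition entropy_rate :: "'a set \<Rightarrow> ('a \<Rightarrow> real) \<Rightarrow> ('a \<Rightarrow> 'a \<Rightarrow> real) \<Rightarrow> real" where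
  "entropy_rate X \<mu> Q = - (\<Sum>i\<in>X. \<Sum>j\<in>X. \<mu> i * Q i j * ln (Q i j))"

definition equilibrium_pair ::
  "'a set \<Rightarrow> ('a \<Rightarrow> 'a set) \<Rightarrow> (('a \<times> 'a \<Rightarrow> real) \<Rightarrow> real) \<Rightarrow>
   ('a \<Rightarrow> real) \<Rightarrow> ('a \<Rightarrow> 'a \<Rightarrow> real) \<Rightarrow> bool" where
  "equilibrium_pair X T E \<mu> Q \<longleftrightarrow>
     stationary_pair X T \<mu> Q \<and>
     (\<forall>\<mu>' Q'. stationary_pair X T \<mu>' Q' \<longrightarrow>
        entropy_rate X \<mu>' Q' + E (two_coord X \<mu>' Q') \<le> entropy_rate X \<mu> Q + E (two_coord X \<mu> Q))"

(* Equality of pairs when kernels agreeing almost everywhere are identified. *)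
definition same_pair ::
  "'a set \<Rightarrow> ('a \<Rightarrow> real) \<Rightarrow> ('a \<Rightarrow> 'a \<Rightarrow> real) \<Rightarrow> ('a \<Rightarrow> real) \<Rightarrow> ('a \<Rightarrow> 'a \<Rightarrow> real) \<Rightarrow> bool" where
  "same_pair X \<mu> Q \<mu>' Q' \<longleftrightarrow>
     (\<forall>i\<in>X. \<mu> i = \<mu>' i) \<and> (\<forall>i\<in>X. \<mu> i \<noteq> 0 \<longrightarrow> (\<forall>j\<in>X. Q i j = Q' i j))"

definition unique_equilibrium ::
  "'a set \<Rightarrow> ('a \<Rightarrow> 'a set) \<Rightarrow> (('a \<times> 'a \<Rightarrow> real) \<Rightarrow> real) \<Rightarrow> bool" where
  "unique_equilibrium X T E \<longleftrightarrow>
     (\<exists>\<mu> Q. equilibrium_pair X T E \<mu> Q \<and>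
        (\<forall>\<mu>' Q'. equilibrium_pair X T E \<mu>' Q' \<longrightarrow> same_pair X \<mu>' Q' \<mu> Q))"

definition several_equilibria ::
  "'a set \<Rightarrow> ('a \<Rightarrow> 'a set) \<Rightarrow> (('a \<times> 'a \<Rightarrow> real) \<Rightarrow> real) \<Rightarrow> bool" where
  "several_equilibria X T E \<longleftrightarrow>
     (\<exists>\<mu> Q \<mu>' Q'. equilibrium_pair X T E \<mu> Q \<and> equilibrium_pair X T E \<mu>' Q' \<and>
        \<not> same_pair X \<mu> Q \<mu>' Q')"

(* Nothing is required at b itself: either behaviour at the separating value is allowed. *)
definition critical_inverse_temperature ::
  "'a set \<Rightarrow> ('a \<Rightarrow> 'a set) \<Rightarrow> (real \<Rightarrow> ('a \<times> 'a \<Rightarrow> real) \<Rightarrow> real) \<Rightarrow> real \<Rightarrow> bool" where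
  "critical_inverse_temperature X T E b \<longleftrightarrow>
     0 \<le> b \<and>
     (\<forall>\<beta>. 0 \<le> \<beta> \<and> \<beta> < b \<longrightarrow> unique_equilibrium X T (E \<beta>)) \<and>
     (\<forall>\<beta>. b < \<beta> \<longrightarrow> several_equilibria X T (E \<beta>))"

definition paths :: "'a set \<Rightarrow> ('a \<Rightarrow> 'a set) \<Rightarrow> nat \<Rightarrow> 'a list set" where
  "paths X T n =
     {xs. length xs = Suc n \<and> set xs \<subseteq> X \<and> (\<forall>j<n. xs ! Suc j \<in> T (xs ! j))}"

definition empirical :: "nat \<Rightarrow> 'a list \<Rightarrow> 'a \<times> 'a \<Rightarrow> real" where
  "empirical n xs = (\<lambda>p. (\<Sum>j<n. of_bool ((xs ! j, xs ! Suc j) = p)) / real n)"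

definition finite_pressure ::
  "'a set \<Rightarrow> ('a \<Rightarrow> 'a set) \<Rightarrow> (('a \<times> 'a \<Rightarrow> real) \<Rightarrow> real) \<Rightarrow> nat \<Rightarrow> real" where
  "finite_pressure X T E n = ln (\<Sum>xs\<in>paths X T n. exp (real n * E (empirical n xs))) / real n"

definition nonlinear_pressure ::
  "'a set \<Rightarrow> ('a \<Rightarrow> 'a set) \<Rightarrow> (('a \<times> 'a \<Rightarrow> real) \<Rightarrow> real) \<Rightarrow> real" where
  "nonlinear_pressure X T E = lim (finite_pressure X T E)"

definition spins :: "int set" where
  "spins = {-1, 1}"

definition spin_map :: "int \<Rightarrow> int set" where
  "spin_map s = spins"

definition \<psi> :: "int \<Rightarrow> int \<Rightarrow> real" where
  "\<psi> s t = real_of_int t"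

definition spin_energy :: "real \<Rightarrow> (int \<times> int \<Rightarrow> real) \<Rightarrow> real" where
  "spin_energy \<beta> \<gamma> = \<beta> / 2 * (\<Sum>(s, t)\<in>spins \<times> spins. \<psi> s t * \<gamma> (s, t))\<^sup>2"

definition spin_law :: "real \<Rightarrow> int \<Rightarrow> real" where
  "spin_law m t = (1 + m * real_of_int t) / 2"

definition magnetization :: "real \<Rightarrow> real" where
  "magnetization \<beta> = (THE m. 0 < m \<and> m = tanh (\<beta> * m))"

(* Invariance under the global spin flip s \<mapsto> -s, the symmetry of the model. *)
definition flip_invariant :: "(int \<Rightarrow> real) \<Rightarrow> (int \<Rightarrow> int \<Rightarrow> real) \<Rightarrow> bool" where
  "flip_invariant \<mu> Q \<longleftrightarrow> same_pair spins (\<lambda>s. \<mu> (- s)) (\<lambda>s t. Q (- s) (- t)) \<mu> Q"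

end

theory Submission imports Defs "HOL-Real_Asymp.Real_Asymp"
begin

text \<open>For a stationary pair with magnetization \<open>m\<close>, comparing each row of the kernel with the
  Gibbs law of the mean field \<open>\<beta> m\<close> shows that entropy rate plus energy equals
  \<open>G(m) = log (2 cosh (\<beta> m)) - \<beta> m\<^sup>2 / 2\<close> minus an average of relative entropies
  (\<open>entropy_plus_energy\<close>). Hence the value is at most \<open>G(m)\<close>, and in the case of equality all
  rows that carry mass are that Gibbs law; by stationarity it is also the one-site law, so that
  \<open>m = tanh (\<beta> m)\<close> (\<open>value_eq_free_energy\<close>). Conversely, at each solution of this mean-field
  equation the product pair has value \<open>G(m)\<close>. The equilibrium pairs are therefore the product
  pairs at those solutions of the mean-field equation that maximize \<open>G\<close>
  (\<open>equilibrium_spin_law\<close>, \<open>equilibrium_pair_cases\<close>).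

  Since \<open>G'(m) = \<beta> (tanh (\<beta> m) - m)\<close>, the rest of the classification is the sign of
  \<open>tanh (\<beta> m) - m\<close> for \<open>m > 0\<close>: it is negative if \<open>\<beta> \<le> 1\<close>, and changes sign exactly once, from
  positive to negative, if \<open>\<beta> > 1\<close>. As \<open>G\<close> is even, its maximum is attained at \<open>0\<close> in the first case and
  only at the two nonzero solutions in the second. The sign also gives continuity at \<open>\<beta> = 1\<close>:
  for each \<open>a > 0\<close> one has \<open>tanh a < a\<close>, which persists for \<open>\<beta>\<close> near \<open>1\<close> and puts the positive
  solution below \<open>a\<close>.

  For the pressure, the quadratic weight \<open>exp (n \<beta> x\<^sup>2 / 2)\<close> of a path with magnetization \<open>x\<close> is
  at least its linearization \<open>exp (n \<beta> (m x - m\<^sup>2 / 2))\<close> for every \<open>m\<close>, with equality for \<open>m = x\<close>.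
  The linearized weights sum to \<open>2 exp (n G(m))\<close>, because the spins become independent. Taking \<open>m\<close>
  to be a maximizer of \<open>G\<close> bounds the partition function from below; bounding each weight by the
  sum of its linearizations at the at most \<open>2n + 1\<close> possible values of \<open>x\<close> bounds it from above.
  The two bounds differ by a factor \<open>2n + 1\<close>, so the pressure is \<open>max G\<close>.\<close>

section \<open>Spin sums\<close>

lemma sum_spins: "(\<Sum>s\<in>spins. f s) = f (-1) + f 1"
  by (simp add: spins_def)

lemma finite_spins: "finite spins"
  by (simp add: spins_def)

section \<open>Relative entropy\<close>

text \<open>Relative entropy of \<open>q\<close> with respect to \<open>p\<close>; the logarithms are multiplied by \<open>q t\<close>, so
  points with \<open>q t = 0\<close> contribute nothing. It is used only for \<open>p\<close> positive on \<open>A\<close>.\<close>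

definition relative_entropy :: "'a set \<Rightarrow> ('a \<Rightarrow> real) \<Rightarrow> ('a \<Rightarrow> real) \<Rightarrow> real" where
  "relative_entropy A q p = (\<Sum>t\<in>A. q t * (ln (q t) - ln (p t)))"

text \<open>The inequality \<open>log x \<le> x - 1\<close> at \<open>x = p / q\<close>, with its case of equality.\<close>

lemma relative_entropy_term:
  fixes p q :: real
  assumes "0 < p" "0 \<le> q"
  shows "q - p \<le> q * (ln q - ln p)" and "q * (ln q - ln p) = q - p \<Longrightarrow> q = p"
proof -
  have "q - p \<le> q * (ln q - ln p) \<and> (q * (ln q - ln p) = q - p \<longrightarrow> q = p)"
  proof (cases "q = 0")
    case False
    with assms have q: "0 < q" by simp
    have ln_ratio: "ln (p / q) = ln p - ln q"
      using assms q by (simp add: ln_div)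
    have "ln (p / q) \<le> p / q - 1"
      using assms q by (intro ln_le_minus_one) simp
    then have "q * (ln p - ln q) \<le> q * (p / q - 1)"
      using q ln_ratio by (intro mult_left_mono) simp_all
    moreover have "q * (p / q - 1) = p - q"
      using q by (simp add: field_simps)
    moreover have "q = p" if "q * (ln q - ln p) = q - p"
    proof -
      have "ln (p / q) = p / q - 1"
        using that q unfolding ln_ratio by (simp add: field_simps)
      then have "p / q = 1"
        using assms q by (intro ln_eq_minus_one) simp_all
      then show ?thesis using q by simp
    qed
    ultimately show ?thesis by (simp add: algebra_simps)
  qed (use assms in simp)
  then show "q - p \<le> q * (ln q - ln p)" and "q * (ln q - ln p) = q - p \<Longrightarrow> q = p"
    by blast+
qed

lemma relative_entropy_nonneg:
  assumes "finite A" "\<And>t. t \<in> A \<Longrightarrow> 0 < p t" "\<And>t. t \<in> A \<Longrightarrow> 0 \<le> q t" "sum q A = sum p A"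
  shows "0 \<le> relative_entropy A q p"
proof -
  have "(\<Sum>t\<in>A. q t - p t) \<le> relative_entropy A q p"
    unfolding relative_entropy_def using assms by (intro sum_mono relative_entropy_term) auto
  then show ?thesis using assms by (simp add: sum_subtractf)
qed

lemma relative_entropy_eq_0:
  assumes "finite A" "\<And>t. t \<in> A \<Longrightarrow> 0 < p t" "\<And>t. t \<in> A \<Longrightarrow> 0 \<le> q t" "sum q A = sum p A"
    and zero: "relative_entropy A q p = 0"
    and t: "t \<in> A"
  shows "q t = p t"
proof -
  have "(\<Sum>t\<in>A. q t * (ln (q t) - ln (p t)) - (q t - p t)) = 0"
    using zero assms(4) by (simp add: relative_entropy_def sum_subtractf)
  moreover have "\<forall>t\<in>A. 0 \<le> q t * (ln (q t) - ln (p t)) - (q t - p t)"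
    using assms relative_entropy_term(1) by fastforce
  ultimately have "\<forall>t\<in>A. q t * (ln (q t) - ln (p t)) - (q t - p t) = 0"
    using assms(1) sum_nonneg_eq_0_iff by (metis (no_types, lifting))
  then show ?thesis
    using relative_entropy_term(2)[of "p t" "q t"] assms t by simp
qed

section \<open>The free energy\<close>

text \<open>The one-spin law with mean \<open>tanh a\<close> is the Gibbs law of the field \<open>a\<close>.\<close>

lemma spin_law_tanh:
  assumes "t \<in> spins"
  shows "spin_law (tanh a) t = exp (a * real_of_int t) / (2 * cosh a)"
proof -
  have "1 + tanh a = exp a / cosh a" "1 - tanh a = exp (-a) / cosh a"
    by (simp_all add: tanh_def field_simps cosh_plus_sinh cosh_minus_sinh)
  with assms show ?thesis
    by (auto simp: spins_def spin_law_def)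
qed

lemma spin_law_tanh_pos: "t \<in> spins \<Longrightarrow> 0 < spin_law (tanh a) t"
  by (simp add: spin_law_tanh)

lemma ln_spin_law_tanh:
  "t \<in> spins \<Longrightarrow> ln (spin_law (tanh a) t) = a * real_of_int t - ln (2 * cosh a)"
  by (simp add: spin_law_tanh ln_div)

lemma sum_spin_law: "(\<Sum>t\<in>spins. spin_law m t) = 1"
  by (simp add: sum_spins spin_law_def field_simps)

text \<open>The free energy of the mean-field Ising model as a function of the magnetization \<open>m\<close>:
  the pressure of independent spins in the field \<open>\<beta> m\<close>, minus the interaction energy that this
  field counts twice.\<close>

definition free_energy :: "real \<Rightarrow> real \<Rightarrow> real" where
  "free_energy \<beta> m = ln (2 * cosh (\<beta> * m)) - \<beta> / 2 * m\<^sup>2"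

text \<open>The magnetization of a law on the two spins.\<close>

definition mean_spin :: "(int \<Rightarrow> real) \<Rightarrow> real" where
  "mean_spin \<mu> = (\<Sum>s\<in>spins. real_of_int s * \<mu> s)"

lemma mean_spin_spin_law: "mean_spin (spin_law m) = m"
  by (simp add: mean_spin_def sum_spins spin_law_def field_simps)

lemma spin_energy_two_coord:
  assumes "stationary_pair spins spin_map \<mu> Q"
  shows "spin_energy \<beta> (two_coord spins \<mu> Q) = \<beta> / 2 * (mean_spin \<mu>)\<^sup>2"
proof -
  have stat: "\<mu> (-1) * Q (-1) j + \<mu> 1 * Q 1 j = \<mu> j" if "j \<in> spins" for j
    using assms that by (simp add: stationary_pair_def sum_spins)
  have "(\<Sum>(s, t)\<in>spins \<times> spins. \<psi> s t * two_coord spins \<mu> Q (s, t)) = mean_spin \<mu>"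
    using stat[of 1] stat[of "-1"]
    by (simp add: spins_def \<psi>_def two_coord_def mean_spin_def sum.cartesian_product[symmetric])
  then show ?thesis by (simp add: spin_energy_def)
qed

text \<open>The energetic and entropic contributions of a stationary pair are completed to the free
  energy at its magnetization; the defect is the relative entropy of the rows of the kernel with
  respect to the Gibbs law of the field \<open>\<beta> m\<close>.\<close>

lemma entropy_plus_energy:
  assumes sp: "stationary_pair spins spin_map \<mu> Q"
  defines "m \<equiv> mean_spin \<mu>"
  shows "entropy_rate spins \<mu> Q + spin_energy \<beta> (two_coord spins \<mu> Q) =
    free_energy \<beta> m -
      (\<Sum>s\<in>spins. \<mu> s * relative_entropy spins (Q s) (spin_law (tanh (\<beta> * m))))"
proof -
  define c where "c = ln (2 * cosh (\<beta> * m))"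
  have rows: "Q (-1) (-1) = 1 - Q (-1) 1" "Q 1 (-1) = 1 - Q 1 1" and mass: "\<mu> (-1) = 1 - \<mu> 1"
    and stat: "\<mu> (-1) * Q (-1) 1 + \<mu> 1 * Q 1 1 = \<mu> 1"
    using sp by (auto simp: stationary_pair_def sum_spins spins_def)
  have m: "m = 2 * \<mu> 1 - 1"
    using mass by (simp add: m_def mean_spin_def sum_spins)
  have logs: "ln (spin_law (tanh (\<beta> * m)) 1) = \<beta> * m - c"
    "ln (spin_law (tanh (\<beta> * m)) (-1)) = - (\<beta> * m) - c"
    by (simp_all add: ln_spin_law_tanh spins_def c_def)
  have "(\<Sum>s\<in>spins. \<mu> s * relative_entropy spins (Q s) (spin_law (tanh (\<beta> * m)))) =
    - entropy_rate spins \<mu> Q + c - \<beta> * m * (2 * (\<mu> (-1) * Q (-1) 1 + \<mu> 1 * Q 1 1) - 1)"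
    unfolding relative_entropy_def entropy_rate_def sum_spins logs rows mass
    by (simp add: algebra_simps)
  then have "(\<Sum>s\<in>spins. \<mu> s * relative_entropy spins (Q s) (spin_law (tanh (\<beta> * m)))) =
    - entropy_rate spins \<mu> Q + c - \<beta> * m\<^sup>2"
    using stat m by (simp add: power2_eq_square)
  then show ?thesis
    using spin_energy_two_coord[OF sp, of \<beta>]
    by (simp add: free_energy_def c_def m_def field_simps)
qed

lemma stationary_pair_spin_law:
  assumes "\<bar>m\<bar> \<le> 1"
  shows "stationary_pair spins spin_map (spin_law m) (\<lambda>s. spin_law m)"
  using assms
  by (auto simp: stationary_pair_def sum_spins spin_map_def spin_law_def spins_def field_simps)

section \<open>Equilibrium pairs\<close>

lemma value_le_free_energy:
  assumes sp: "stationary_pair spins spin_map \<mu> Q"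
  shows "entropy_rate spins \<mu> Q + spin_energy \<beta> (two_coord spins \<mu> Q) \<le> free_energy \<beta> (mean_spin \<mu>)"
proof -
  have "0 \<le> \<mu> s * relative_entropy spins (Q s) (spin_law (tanh (\<beta> * mean_spin \<mu>)))"
    if "s \<in> spins" for s
    using sp that
    by (intro mult_nonneg_nonneg relative_entropy_nonneg)
      (auto simp: stationary_pair_def sum_spin_law spin_law_tanh_pos finite_spins)
  then show ?thesis
    unfolding entropy_plus_energy[OF sp] by (simp add: sum_nonneg)
qed

text \<open>If the bound by the free energy is attained, every charged row of the kernel is the Gibbs
  law; by stationarity this is then also the law of a single spin, which gives the mean-field
  equation.\<close>

lemma value_eq_free_energy:
  assumes sp: "stationary_pair spins spin_map \<mu> Q"
    and eq: "entropy_rate spins \<mu> Q + spin_energy \<beta> (two_coord spins \<mu> Q) = free_energy \<beta> (mean_spin \<mu>)"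
  defines "m \<equiv> mean_spin \<mu>"
  shows "m = tanh (\<beta> * m)" and "same_pair spins \<mu> Q (spin_law m) (\<lambda>s. spin_law m)"
proof -
  define p where "p = spin_law (tanh (\<beta> * m))"
  have nonneg: "0 \<le> relative_entropy spins (Q s) p" if "s \<in> spins" for s
    using sp that unfolding p_def
    by (intro relative_entropy_nonneg)
      (auto simp: stationary_pair_def sum_spin_law spin_law_tanh_pos finite_spins)
  have "(\<Sum>s\<in>spins. \<mu> s * relative_entropy spins (Q s) p) = 0"
    using entropy_plus_energy[OF sp, of \<beta>] eq by (simp add: p_def m_def)
  moreover have "\<forall>s\<in>spins. 0 \<le> \<mu> s * relative_entropy spins (Q s) p"
    using nonneg sp by (simp add: stationary_pair_def)
  ultimately have zero: "\<forall>s\<in>spins. \<mu> s * relative_entropy spins (Q s) p = 0"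
    using sum_nonneg_eq_0_iff[OF finite_spins] by (metis (no_types, lifting))
  have rows: "Q s t = p t" if "s \<in> spins" "\<mu> s \<noteq> 0" "t \<in> spins" for s t
  proof (rule relative_entropy_eq_0[OF finite_spins])
    show "relative_entropy spins (Q s) p = 0" using zero that by (metis mult_eq_0_iff)
  qed (use sp that in \<open>auto simp: stationary_pair_def sum_spin_law spin_law_tanh_pos p_def\<close>)
  have mu: "\<mu> t = p t" if t: "t \<in> spins" for t
  proof -
    have "\<mu> t = (\<Sum>s\<in>spins. \<mu> s * Q s t)" using sp t by (simp add: stationary_pair_def)
    also have "\<dots> = (\<Sum>s\<in>spins. \<mu> s * p t)" using rows t by (intro sum.cong) auto
    also have "\<dots> = p t" using sp by (simp add: stationary_pair_def sum_distrib_right[symmetric])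
    finally show ?thesis .
  qed
  have "m = mean_spin p" using mu by (simp add: m_def mean_spin_def)
  then show m: "m = tanh (\<beta> * m)" by (simp add: p_def mean_spin_spin_law)
  show "same_pair spins \<mu> Q (spin_law m) (\<lambda>s. spin_law m)"
    using mu rows unfolding p_def m[symmetric] same_pair_def by simp
qed

lemma value_spin_law:
  assumes m: "m = tanh (\<beta> * m)"
  shows "entropy_rate spins (spin_law m) (\<lambda>s. spin_law m) +
    spin_energy \<beta> (two_coord spins (spin_law m) (\<lambda>s. spin_law m)) = free_energy \<beta> m"
proof -
  have "\<bar>m\<bar> \<le> 1"
    using tanh_real_bounds[of "\<beta> * m"] m by (auto simp: abs_le_iff)
  from entropy_plus_energy[OF stationary_pair_spin_law[OF this], of \<beta>] show ?thesis
    by (simp add: mean_spin_spin_law m[symmetric] relative_entropy_def)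
qed

lemma equilibrium_spin_law:
  assumes m: "m = tanh (\<beta> * m)" and max: "\<And>x. free_energy \<beta> x \<le> free_energy \<beta> m"
  shows "equilibrium_pair spins spin_map (spin_energy \<beta>) (spin_law m) (\<lambda>s. spin_law m)"
proof -
  have "\<bar>m\<bar> \<le> 1"
    using tanh_real_bounds[of "\<beta> * m"] m by (auto simp: abs_le_iff)
  then show ?thesis
    unfolding equilibrium_pair_def value_spin_law[OF m]
    using stationary_pair_spin_law order_trans[OF value_le_free_energy max] by blast
qed

lemma equilibrium_pair_cases:
  assumes m: "m = tanh (\<beta> * m)" and max: "\<And>x. free_energy \<beta> x \<le> free_energy \<beta> m"
    and eq: "equilibrium_pair spins spin_map (spin_energy \<beta>) \<mu> Q"
  obtains m' where "m' = tanh (\<beta> * m')" "free_energy \<beta> m' = free_energy \<beta> m"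
    "same_pair spins \<mu> Q (spin_law m') (\<lambda>s. spin_law m')"
proof -
  have sp: "stationary_pair spins spin_map \<mu> Q"
    using eq by (simp add: equilibrium_pair_def)
  have "free_energy \<beta> m \<le> entropy_rate spins \<mu> Q + spin_energy \<beta> (two_coord spins \<mu> Q)"
    using eq equilibrium_spin_law[OF m max] value_spin_law[OF m]
    unfolding equilibrium_pair_def by metis
  with value_le_free_energy[OF sp, of \<beta>] max[of "mean_spin \<mu>"]
  have "entropy_rate spins \<mu> Q + spin_energy \<beta> (two_coord spins \<mu> Q) = free_energy \<beta> (mean_spin \<mu>)"
    and "free_energy \<beta> (mean_spin \<mu>) = free_energy \<beta> m"
    by linarith+
  with value_eq_free_energy[OF sp] that show thesis by blast
qed

section \<open>The mean-field equation\<close>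

lemma DERIV_tanh_minus_id:
  "((\<lambda>x. tanh (\<beta> * x) - x) has_real_derivative \<beta> * (1 - (tanh (\<beta> * x))\<^sup>2) - 1) (at x)"
  by (auto intro!: derivative_eq_intros simp: algebra_simps)

lemma continuous_tanh_minus_id: "continuous_on A (\<lambda>x::real. tanh (\<beta> * x) - x)"
  by (intro continuous_intros) simp

lemma DERIV_free_energy:
  "(free_energy \<beta> has_real_derivative \<beta> * (tanh (\<beta> * x) - x)) (at x)"
  unfolding free_energy_def [abs_def]
  by (auto intro!: derivative_eq_intros simp: tanh_def field_simps)

lemma free_energy_abs: "free_energy \<beta> \<bar>x\<bar> = free_energy \<beta> x"
  by (cases "x \<ge> 0") (simp_all add: free_energy_def)

lemma tanh_less_id:
  assumes "0 < (x::real)"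
  shows "tanh x < x"
proof -
  have "\<exists>z>0. z < x \<and> (tanh x - x) - (tanh 0 - 0) = (x - 0) * (- (tanh z)\<^sup>2)"
    using assms DERIV_tanh_minus_id[of 1]
    by (intro MVT2) simp_all
  then obtain z where z: "0 < z" "tanh x - x = - (x * (tanh z)\<^sup>2)"
    by auto
  from z(1) have "tanh z \<noteq> 0" by simp
  then have "0 < x * (tanh z)\<^sup>2" using assms by simp
  with z(2) show ?thesis by linarith
qed

lemma tanh_mult_less_id:
  assumes "\<beta> \<le> 1" "0 < (x::real)"
  shows "tanh (\<beta> * x) < x"
proof -
  have "tanh (\<beta> * x) \<le> tanh x" using assms by simp
  also have "\<dots> < x" using assms by (intro tanh_less_id)
  finally show ?thesis .
qed

text \<open>Two positive solutions would, with the solution \<open>0\<close>, force the derivative of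
  \<open>tanh (\<beta> x) - x\<close> to vanish at two positive points by Rolle's theorem, although this derivative
  is strictly decreasing there.\<close>

lemma mean_field_unique:
  fixes \<beta> x y :: real
  assumes \<beta>: "0 < \<beta>" and x: "0 < x" "x = tanh (\<beta> * x)" and y: "0 < y" "y = tanh (\<beta> * y)"
  shows "x = y"
proof -
  have False if "0 < x" "x < y" "x = tanh (\<beta> * x)" "y = tanh (\<beta> * y)" for x y
  proof -
    have "\<exists>z>0. z < x \<and> (tanh (\<beta> * x) - x) - (tanh (\<beta> * 0) - 0)
        = (x - 0) * (\<beta> * (1 - (tanh (\<beta> * z))\<^sup>2) - 1)"
      using that DERIV_tanh_minus_id[of \<beta>] by (intro MVT2) simp_all
    moreover have "(tanh (\<beta> * x) - x) - (tanh (\<beta> * 0) - 0) = 0" "x - 0 \<noteq> 0"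
      using that by simp_all
    ultimately obtain u where u: "0 < u" "u < x" "\<beta> * (1 - (tanh (\<beta> * u))\<^sup>2) - 1 = 0"
      by (metis mult_eq_0_iff)
    have "\<exists>z>x. z < y \<and> (tanh (\<beta> * y) - y) - (tanh (\<beta> * x) - x)
        = (y - x) * (\<beta> * (1 - (tanh (\<beta> * z))\<^sup>2) - 1)"
      using that DERIV_tanh_minus_id[of \<beta>] by (intro MVT2) simp_all
    moreover have "(tanh (\<beta> * y) - y) - (tanh (\<beta> * x) - x) = 0" "y - x \<noteq> 0"
      using that by simp_all
    ultimately obtain v where v: "x < v" "\<beta> * (1 - (tanh (\<beta> * v))\<^sup>2) - 1 = 0"
      by (metis mult_eq_0_iff)
    have "\<beta> * (1 - (tanh (\<beta> * u))\<^sup>2) = \<beta> * (1 - (tanh (\<beta> * v))\<^sup>2)"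
      using u(3) v(2) by linarith
    then have "(tanh (\<beta> * u))\<^sup>2 = (tanh (\<beta> * v))\<^sup>2"
      using \<beta> by simp
    moreover have "0 \<le> tanh (\<beta> * u)" "tanh (\<beta> * u) < tanh (\<beta> * v)"
      using \<beta> u v by simp_all
    ultimately show False
      by (metis power2_eq_imp_eq less_irrefl order.strict_implies_order order.trans)
  qed
  with x y show ?thesis by (metis linorder_neqE_linordered_idom)
qed

lemma tanh_mult_above_id_near_0:
  assumes "1 < (\<beta>::real)" "0 < \<epsilon>"
  obtains x where "0 < x" "x < \<epsilon>" "x < tanh (\<beta> * x)"
proof -
  have "\<exists>d>0. \<forall>h>0. h < d \<longrightarrow> (tanh (\<beta> * 0) - 0) < (tanh (\<beta> * (0 + h)) - (0 + h))"
    using DERIV_tanh_minus_id[of \<beta> 0] assms(1)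
    by (intro DERIV_pos_inc_right[where l = "\<beta> * (1 - (tanh (\<beta> * 0))\<^sup>2) - 1"]) simp_all
  then obtain d where d: "0 < d" "\<And>h. 0 < h \<Longrightarrow> h < d \<Longrightarrow> h < tanh (\<beta> * h)"
    by auto
  obtain x where "0 < x" "x < min d \<epsilon>"
    using dense[of 0 "min d \<epsilon>"] d(1) assms(2) by auto
  with d(2) show thesis
    by (intro that[of x]) simp_all
qed

lemma mean_field_zero_between:
  fixes \<beta> x y :: real
  assumes "x \<le> y" "x \<le> tanh (\<beta> * x)" "tanh (\<beta> * y) \<le> y"
  obtains z where "x \<le> z" "z \<le> y" "z = tanh (\<beta> * z)"
  using IVT2'[of "\<lambda>x. tanh (\<beta> * x) - x" y 0 x, OF _ _ _ continuous_tanh_minus_id] assms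
  by (auto simp: algebra_simps)

lemma mean_field_ex1:
  assumes "1 < (\<beta>::real)"
  shows "\<exists>!m. 0 < m \<and> m = tanh (\<beta> * m)"
proof -
  obtain x where x: "0 < x" "x < 1" "x < tanh (\<beta> * x)"
    using tanh_mult_above_id_near_0[OF assms, of 1] by auto
  have "tanh (\<beta> * 1) \<le> 1"
    using tanh_real_lt_1[of \<beta>] by simp
  with x obtain z where "x \<le> z" "z = tanh (\<beta> * z)"
    using mean_field_zero_between[of x 1 \<beta>] by auto
  then have "0 < z \<and> z = tanh (\<beta> * z)" using x by simp
  with mean_field_unique[of \<beta>] assms show ?thesis
    by (intro ex1I[of _ z]) auto
qed

lemma magnetization:
  assumes "1 < \<beta>"
  shows magnetization_pos: "0 < magnetization \<beta>"
    and magnetization_eq: "magnetization \<beta> = tanh (\<beta> * magnetization \<beta>)"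
  using theI'[OF mean_field_ex1[OF assms]] by (simp_all add: magnetization_def)

lemma magnetization_less_1: "1 < \<beta> \<Longrightarrow> magnetization \<beta> < 1"
  by (metis magnetization_eq tanh_real_lt_1)

lemma mean_field_solutions:
  assumes \<beta>: "1 < \<beta>" and m: "m = tanh (\<beta> * m)"
  shows "m \<in> {- magnetization \<beta>, 0, magnetization \<beta>}"
proof -
  have "x = magnetization \<beta>" if "0 < x" "x = tanh (\<beta> * x)" for x
    using mean_field_unique[of \<beta>] \<beta> that magnetization[OF \<beta>] by simp
  from this[of m] this[of "- m"] m show ?thesis
    by (cases m "0::real" rule: linorder_cases) auto
qed

lemma tanh_above_id_below_magnetization:
  assumes \<beta>: "1 < \<beta>" and x: "0 < x" "x < magnetization \<beta>"
  shows "x < tanh (\<beta> * x)"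
proof (rule ccontr)
  assume "\<not> x < tanh (\<beta> * x)"
  moreover obtain y where y: "0 < y" "y < x" "y < tanh (\<beta> * y)"
    using tanh_mult_above_id_near_0[OF \<beta> x(1)] .
  ultimately obtain z where "y \<le> z" "z \<le> x" "z = tanh (\<beta> * z)"
    using mean_field_zero_between[of y x \<beta>] by auto
  then show False
    using mean_field_solutions[OF \<beta>, of z] y x by auto
qed

lemma tanh_below_id_above_magnetization:
  assumes \<beta>: "1 < \<beta>" and x: "magnetization \<beta> < x"
  shows "tanh (\<beta> * x) < x"
proof (rule ccontr)
  assume "\<not> tanh (\<beta> * x) < x"
  moreover from this have "x < 1"
    using tanh_real_lt_1[of "\<beta> * x"] by linarith
  moreover have "tanh (\<beta> * 1) \<le> 1"
    using tanh_real_lt_1[of \<beta>] by simp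
  ultimately obtain z where "x \<le> z" "z = tanh (\<beta> * z)"
    using mean_field_zero_between[of x 1 \<beta>] by auto
  then show False
    using mean_field_solutions[OF \<beta>, of z] x magnetization_pos[OF \<beta>] by auto
qed

lemma magnetization_tendsto_0: "(magnetization \<longlongrightarrow> 0) (at_right 1)"
proof (rule order_tendstoI)
  fix a :: real assume "a < 0"
  have "a < magnetization \<beta>" if "1 < \<beta>" for \<beta>
    using magnetization_pos[OF that] \<open>a < 0\<close> by linarith
  then show "\<forall>\<^sub>F \<beta> in at_right 1. a < magnetization \<beta>"
    by (auto intro!: eventually_at_rightI[of 1 2])
next
  fix a :: real assume a: "0 < a"
  have "((\<lambda>\<beta>. tanh (\<beta> * a)) \<longlongrightarrow> tanh (1 * a)) (at_right 1)"
    by (intro tendsto_intros) simp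
  then have "\<forall>\<^sub>F \<beta> in at_right 1. tanh (\<beta> * a) < a"
    by (rule order_tendstoD(2)) (use tanh_less_id[OF a] in simp)
  moreover have "\<forall>\<^sub>F \<beta> in at_right (1::real). 1 < \<beta>"
    by (auto intro!: eventually_at_rightI[of 1 2])
  ultimately show "\<forall>\<^sub>F \<beta> in at_right 1. magnetization \<beta> < a"
  proof eventually_elim
    case (elim \<beta>)
    then show ?case
      using tanh_above_id_below_magnetization[OF \<open>1 < \<beta>\<close> a] magnetization_eq[OF \<open>1 < \<beta>\<close>]
      by (metis less_asym linorder_neqE_linordered_idom)
  qed
qed

section \<open>Maximizers of the free energy\<close>

lemma free_energy_mono:
  assumes "0 < \<beta>" "x < y" "\<And>z. x < z \<Longrightarrow> z < y \<Longrightarrow> z < tanh (\<beta> * z)"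
  shows "free_energy \<beta> x < free_energy \<beta> y"
proof -
  have "\<exists>z>x. z < y \<and> free_energy \<beta> y - free_energy \<beta> x = (y - x) * (\<beta> * (tanh (\<beta> * z) - z))"
    using assms(2) DERIV_free_energy by (intro MVT2) simp_all
  then obtain z where z: "x < z" "z < y"
    and eq: "free_energy \<beta> y - free_energy \<beta> x = (y - x) * (\<beta> * (tanh (\<beta> * z) - z))"
    by blast
  have "0 < (y - x) * (\<beta> * (tanh (\<beta> * z) - z))"
    using assms z by simp
  with eq show ?thesis by linarith
qed

lemma free_energy_antimono:
  assumes "0 \<le> \<beta>" "x \<le> y" "\<And>z. x < z \<Longrightarrow> z < y \<Longrightarrow> tanh (\<beta> * z) < z"
  shows "free_energy \<beta> y \<le> free_energy \<beta> x"
proof (cases "x = y")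
  case False
  have "\<exists>z>x. z < y \<and> free_energy \<beta> y - free_energy \<beta> x = (y - x) * (\<beta> * (tanh (\<beta> * z) - z))"
    using assms(2) False DERIV_free_energy by (intro MVT2) simp_all
  then obtain z where z: "x < z" "z < y"
    and eq: "free_energy \<beta> y - free_energy \<beta> x = (y - x) * (\<beta> * (tanh (\<beta> * z) - z))"
    by blast
  have "(y - x) * (\<beta> * (tanh (\<beta> * z) - z)) \<le> 0"
    using assms(1,3) z by (intro mult_nonneg_nonpos) (auto simp: less_imp_le)
  with eq show ?thesis by linarith
qed simp

lemma free_energy_max_subcritical:
  assumes "0 \<le> \<beta>" "\<beta> \<le> 1"
  shows "free_energy \<beta> x \<le> free_energy \<beta> 0"
proof -
  have "free_energy \<beta> \<bar>x\<bar> \<le> free_energy \<beta> 0"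
    using assms tanh_mult_less_id by (intro free_energy_antimono) auto
  then show ?thesis by (simp add: free_energy_abs)
qed

lemma free_energy_0_less_magnetization:
  assumes "1 < \<beta>"
  shows "free_energy \<beta> 0 < free_energy \<beta> (magnetization \<beta>)"
  using assms magnetization_pos tanh_above_id_below_magnetization
  by (intro free_energy_mono) auto

lemma free_energy_max_supercritical:
  assumes "1 < \<beta>"
  shows "free_energy \<beta> x \<le> free_energy \<beta> (magnetization \<beta>)"
proof -
  have "free_energy \<beta> \<bar>x\<bar> \<le> free_energy \<beta> (magnetization \<beta>)"
  proof (cases "\<bar>x\<bar> < magnetization \<beta>")
    case True
    then show ?thesis
      using assms tanh_above_id_below_magnetization
      by (intro less_imp_le free_energy_mono) auto
  next
    case False
    then show ?thesis
      using assms tanh_below_id_above_magnetization by (intro free_energy_antimono) auto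
  qed
  then show ?thesis by (simp add: free_energy_abs)
qed

section \<open>The nonlinear pressure\<close>

text \<open>The weights of words factorize over the letters.\<close>

lemma sum_prod_list_words:
  fixes f :: "'a \<Rightarrow> 'b::comm_semiring_1"
  assumes "finite A"
  shows "(\<Sum>xs | set xs \<subseteq> A \<and> length xs = n. \<Prod>x\<leftarrow>xs. f x) = (\<Sum>x\<in>A. f x) ^ n"
proof (induction n)
  case 0
  have "{xs. set xs \<subseteq> A \<and> length xs = 0} = {[]}" by auto
  then show ?case by simp
next
  case (Suc n)
  have "(\<Sum>xs | set xs \<subseteq> A \<and> length xs = Suc n. \<Prod>x\<leftarrow>xs. f x) =
    (\<Sum>(x, xs)\<in>A \<times> {xs. set xs \<subseteq> A \<and> length xs = n}. f x * (\<Prod>x\<leftarrow>xs. f x))"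
    by (rule sum.reindex_bij_witness[of _ "\<lambda>(x, xs). x # xs" "\<lambda>xs. (hd xs, tl xs)"])
      (auto simp: length_Suc_conv)
  also have "\<dots> = (\<Sum>x\<in>A. f x) * (\<Sum>xs | set xs \<subseteq> A \<and> length xs = n. \<Prod>x\<leftarrow>xs. f x)"
    by (simp add: sum_product sum.cartesian_product)
  finally show ?case by (simp add: Suc)
qed

text \<open>Total spin of a path; the initial site does not contribute, because the interaction only
  sees the second coordinate of each transition.\<close>

definition total_spin :: "int list \<Rightarrow> int" where
  "total_spin xs = sum_list (tl xs)"

lemma paths_spins: "paths spins spin_map n = {xs. set xs \<subseteq> spins \<and> length xs = Suc n}"
  by (auto simp: paths_def spin_map_def subset_iff)

lemma sum_exp_total_spin:
  "(\<Sum>xs\<in>paths spins spin_map n. exp (a * real_of_int (total_spin xs))) = 2 * (2 * cosh a) ^ n"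
proof -
  let ?W = "{xs. set xs \<subseteq> spins \<and> length xs = n}"
  have exp_sum: "exp (a * real_of_int (sum_list ys)) = (\<Prod>y\<leftarrow>ys. exp (a * real_of_int y))" for ys
    by (induction ys) (simp_all add: distrib_left exp_add)
  have "(\<Sum>xs\<in>paths spins spin_map n. exp (a * real_of_int (total_spin xs))) =
    (\<Sum>(x, ys)\<in>spins \<times> ?W. \<Prod>y\<leftarrow>ys. exp (a * real_of_int y))"
    unfolding paths_spins
    by (rule sum.reindex_bij_witness[of _ "\<lambda>(x, xs). x # xs" "\<lambda>xs. (hd xs, tl xs)"])
      (auto simp: length_Suc_conv total_spin_def exp_sum)
  also have "\<dots> = (\<Sum>x\<in>spins. \<Sum>ys\<in>?W. \<Prod>y\<leftarrow>ys. exp (a * real_of_int y))"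
    by (rule sum.cartesian_product[symmetric])
  also have "\<dots> = 2 * (exp (- a) + exp a) ^ n"
    unfolding sum_prod_list_words[OF finite_spins] sum_spins by simp
  also have "exp (- a) + exp a = 2 * cosh a"
    by (simp add: cosh_def)
  finally show ?thesis .
qed

lemma spin_energy_empirical:
  assumes "xs \<in> paths spins spin_map n"
  shows "spin_energy \<beta> (empirical n xs) = \<beta> / 2 * (real_of_int (total_spin xs) / real n)\<^sup>2"
proof -
  from assms have len: "length xs = Suc n" and sub: "set xs \<subseteq> spins"
    by (simp_all add: paths_spins)
  have mem: "xs ! i \<in> spins" if "i \<le> n" for i
    using sub len that by (auto simp: subset_iff)
  have "(\<Sum>p\<in>spins \<times> spins. real_of_int (snd p) * empirical n xs p) =
    (\<Sum>j<n. \<Sum>p\<in>spins \<times> spins. real_of_int (snd p) * of_bool ((xs ! j, xs ! Suc j) = p)) / real n"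
    unfolding empirical_def sum_divide_distrib sum_distrib_left
    by (subst sum.swap) (simp add: sum_divide_distrib)
  also have "(\<Sum>j<n. \<Sum>p\<in>spins \<times> spins. real_of_int (snd p) * of_bool ((xs ! j, xs ! Suc j) = p)) =
    (\<Sum>j<n. real_of_int (xs ! Suc j))"
  proof (intro sum.cong refl)
    fix j assume "j \<in> {..<n}"
    then have "(xs ! j, xs ! Suc j) \<in> spins \<times> spins" using mem by auto
    moreover have "(\<Sum>p\<in>spins \<times> spins. real_of_int (snd p) * of_bool ((xs ! j, xs ! Suc j) = p)) =
      (\<Sum>p\<in>spins \<times> spins. if (xs ! j, xs ! Suc j) = p then real_of_int (snd p) else 0)"
      by (intro sum.cong) auto
    ultimately show "(\<Sum>p\<in>spins \<times> spins. real_of_int (snd p) * of_bool ((xs ! j, xs ! Suc j) = p)) =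
      real_of_int (xs ! Suc j)"
      using finite_spins by simp
  qed
  also have "\<dots> = real_of_int (total_spin xs)"
    using len by (simp add: total_spin_def sum_list_sum_nth nth_tl atLeast0LessThan)
  finally show ?thesis
    by (simp add: spin_energy_def \<psi>_def case_prod_unfold)
qed

lemma abs_total_spin_le:
  assumes "xs \<in> paths spins spin_map n"
  shows "\<bar>total_spin xs\<bar> \<le> int n"
proof -
  have "\<bar>sum_list ys\<bar> \<le> int (length ys)" if "set ys \<subseteq> spins" for ys
    using that by (induction ys) (auto simp: spins_def)
  from this[of "tl xs"] assms show ?thesis
    by (cases xs) (auto simp: paths_spins total_spin_def)
qed

text \<open>The sum of the path weights whose exponential growth rate is the nonlinear pressure.\<close>

definition partition_function :: "real \<Rightarrow> nat \<Rightarrow> real" where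
  "partition_function \<beta> n =
    (\<Sum>xs\<in>paths spins spin_map n. exp (real n * spin_energy \<beta> (empirical n xs)))"

text \<open>Summing the linearized weight over all paths is a computation for independent spins.\<close>

lemma sum_exp_linearized:
  assumes "0 < n"
  shows "(\<Sum>xs\<in>paths spins spin_map n.
      exp (\<beta> * m * real_of_int (total_spin xs) - real n * (\<beta> / 2 * m\<^sup>2))) =
    2 * exp (real n * free_energy \<beta> m)"
proof -
  have "(\<Sum>xs\<in>paths spins spin_map n.
      exp (\<beta> * m * real_of_int (total_spin xs) - real n * (\<beta> / 2 * m\<^sup>2))) =
    2 * (2 * cosh (\<beta> * m)) ^ n / exp (real n * (\<beta> / 2 * m\<^sup>2))"
    by (simp add: exp_diff sum_divide_distrib[symmetric] sum_exp_total_spin)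
  also have "(2 * cosh (\<beta> * m)) ^ n = exp (real n * ln (2 * cosh (\<beta> * m)))"
    by (simp add: exp_of_nat_mult)
  finally show ?thesis
    by (simp add: free_energy_def right_diff_distrib exp_diff)
qed

text \<open>The remainder of the linearization at \<open>m\<close> has the sign of \<open>\<beta>\<close> and vanishes when \<open>m\<close> is
  the magnetization \<open>S / n\<close> of the path.\<close>

lemma quadratic_linearization:
  fixes \<beta> m S :: real
  assumes "0 < n"
  shows "real n * (\<beta> / 2 * (S / real n)\<^sup>2) =
    \<beta> * m * S - real n * (\<beta> / 2 * m\<^sup>2) + real n * (\<beta> / 2 * (S / real n - m)\<^sup>2)"
  using assms by (simp add: power2_eq_square field_simps)

lemma partition_function_ge:
  assumes "0 \<le> \<beta>" "0 < n"
  shows "2 * exp (real n * free_energy \<beta> m) \<le> partition_function \<beta> n"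
  unfolding sum_exp_linearized[OF assms(2), symmetric] partition_function_def
proof (rule sum_mono)
  fix xs assume "xs \<in> paths spins spin_map n"
  then show "exp (\<beta> * m * real_of_int (total_spin xs) - real n * (\<beta> / 2 * m\<^sup>2)) \<le>
    exp (real n * spin_energy \<beta> (empirical n xs))"
    using assms(1) quadratic_linearization[OF assms(2), of \<beta> "real_of_int (total_spin xs)" m]
    by (simp add: spin_energy_empirical)
qed

text \<open>The magnetization of a path takes at most \<open>2n + 1\<close> values, and the linearization at the
  right value is exact.\<close>

lemma partition_function_le:
  assumes n: "0 < n" and max: "\<And>x. free_energy \<beta> x \<le> F"
  shows "partition_function \<beta> n \<le> 2 * (2 * real n + 1) * exp (real n * F)"
proof -
  let ?w = "\<lambda>k xs. exp (\<beta> * (real_of_int k / real n) * real_of_int (total_spin xs)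
    - real n * (\<beta> / 2 * (real_of_int k / real n)\<^sup>2))"
  have "exp (real n * spin_energy \<beta> (empirical n xs)) \<le> (\<Sum>k\<in>{- int n..int n}. ?w k xs)"
    if xs: "xs \<in> paths spins spin_map n" for xs
  proof -
    have "total_spin xs \<in> {- int n..int n}"
      using abs_total_spin_le[OF xs] by auto
    then have "?w (total_spin xs) xs \<le> (\<Sum>k\<in>{- int n..int n}. ?w k xs)"
      by (intro member_le_sum) auto
    moreover have "real n * spin_energy \<beta> (empirical n xs) =
      \<beta> * (real_of_int (total_spin xs) / real n) * real_of_int (total_spin xs)
        - real n * (\<beta> / 2 * (real_of_int (total_spin xs) / real n)\<^sup>2)"
      unfolding spin_energy_empirical[OF xs]
      using quadratic_linearization[OF n, of \<beta> "real_of_int (total_spin xs)"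
        "real_of_int (total_spin xs) / real n"] by simp
    ultimately show ?thesis by simp
  qed
  then have "partition_function \<beta> n \<le>
    (\<Sum>xs\<in>paths spins spin_map n. \<Sum>k\<in>{- int n..int n}. ?w k xs)"
    unfolding partition_function_def by (rule sum_mono)
  also have "\<dots> = (\<Sum>k\<in>{- int n..int n}. 2 * exp (real n * free_energy \<beta> (real_of_int k / real n)))"
    unfolding sum_exp_linearized[OF n, symmetric] by (rule sum.swap)
  also have "\<dots> \<le> (\<Sum>k\<in>{- int n..int n}. 2 * exp (real n * F))"
    using max by (intro sum_mono) (simp add: mult_left_mono)
  also have "\<dots> = 2 * (2 * real n + 1) * exp (real n * F)"
    by simp
  finally show ?thesis .
qed

lemma finite_pressure_tendsto:
  assumes \<beta>: "0 \<le> \<beta>" and max: "\<And>x. free_energy \<beta> x \<le> free_energy \<beta> m"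
  shows "finite_pressure spins spin_map (spin_energy \<beta>) \<longlonglongrightarrow> free_energy \<beta> m"
proof (rule tendsto_sandwich)
  let ?F = "free_energy \<beta> m"
  have pressure: "finite_pressure spins spin_map (spin_energy \<beta>) n =
    ln (partition_function \<beta> n) / real n" for n
    by (simp add: finite_pressure_def partition_function_def)
  have ln_bound: "ln (c * exp (real n * ?F)) / real n = ?F + ln c / real n"
    if "0 < n" "0 < c" for n c
    using that by (simp add: ln_mult add_divide_distrib)
  show "\<forall>\<^sub>F n in sequentially. ?F + ln 2 / real n \<le> finite_pressure spins spin_map (spin_energy \<beta>) n"
    using eventually_gt_at_top[of 0]
  proof eventually_elim
    case (elim n)
    have "ln (2 * exp (real n * ?F)) \<le> ln (partition_function \<beta> n)"
      using partition_function_ge[OF \<beta> elim, of m] by (intro ln_mono) auto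
    then have "ln (2 * exp (real n * ?F)) / real n \<le> ln (partition_function \<beta> n) / real n"
      by (intro divide_right_mono) auto
    then show ?case
      using ln_bound[OF elim, of 2] unfolding pressure by simp
  qed
  show "\<forall>\<^sub>F n in sequentially. finite_pressure spins spin_map (spin_energy \<beta>) n \<le>
    ?F + ln (2 * (2 * real n + 1)) / real n"
    using eventually_gt_at_top[of 0]
  proof eventually_elim
    case (elim n)
    have "0 < partition_function \<beta> n"
      using partition_function_ge[OF \<beta> elim, of m] by (rule less_le_trans[rotated]) simp
    then have "ln (partition_function \<beta> n) \<le> ln (2 * (2 * real n + 1) * exp (real n * ?F))"
      using partition_function_le[OF elim max] by (intro ln_mono) auto
    then have "ln (partition_function \<beta> n) / real n \<le>
      ln (2 * (2 * real n + 1) * exp (real n * ?F)) / real n"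
      by (intro divide_right_mono) auto
    then show ?case
      using ln_bound[OF elim, of "2 * (2 * real n + 1)"] unfolding pressure by simp
  qed
  show "(\<lambda>n. ?F + ln 2 / real n) \<longlonglongrightarrow> ?F"
    by real_asymp
  show "(\<lambda>n. ?F + ln (2 * (2 * real n + 1)) / real n) \<longlonglongrightarrow> ?F"
    by real_asymp
qed

lemma convergent_finite_pressure:
  assumes "0 \<le> \<beta>"
  shows "convergent (finite_pressure spins spin_map (spin_energy \<beta>))"
    and "nonlinear_pressure spins spin_map (spin_energy \<beta>) =
      (if \<beta> \<le> 1 then ln 2
       else ln (2 * cosh (\<beta> * magnetization \<beta>)) - \<beta> / 2 * (magnetization \<beta>)\<^sup>2)"
proof -
  define m where "m = (if \<beta> \<le> 1 then 0 else magnetization \<beta>)"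
  have "free_energy \<beta> x \<le> free_energy \<beta> m" for x
    using assms free_energy_max_subcritical free_energy_max_supercritical by (simp add: m_def)
  from finite_pressure_tendsto[OF assms this]
  have lim: "finite_pressure spins spin_map (spin_energy \<beta>) \<longlonglongrightarrow> free_energy \<beta> m" .
  then show "convergent (finite_pressure spins spin_map (spin_energy \<beta>))"
    by (rule convergentI)
  have "free_energy \<beta> m = (if \<beta> \<le> 1 then ln 2
       else ln (2 * cosh (\<beta> * magnetization \<beta>)) - \<beta> / 2 * (magnetization \<beta>)\<^sup>2)"
    by (simp add: m_def free_energy_def)
  with limI[OF lim] show "nonlinear_pressure spins spin_map (spin_energy \<beta>) =
      (if \<beta> \<le> 1 then ln 2
       else ln (2 * cosh (\<beta> * magnetization \<beta>)) - \<beta> / 2 * (magnetization \<beta>)\<^sup>2)"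
    by (simp add: nonlinear_pressure_def)
qed

section \<open>The phase transition\<close>

lemma same_pair_sym: "same_pair X \<mu> Q \<mu>' Q' \<Longrightarrow> same_pair X \<mu>' Q' \<mu> Q"
  by (auto simp: same_pair_def)

lemma same_pair_trans:
  "same_pair X \<mu> Q \<mu>' Q' \<Longrightarrow> same_pair X \<mu>' Q' \<mu>'' Q'' \<Longrightarrow> same_pair X \<mu> Q \<mu>'' Q''"
  by (auto simp: same_pair_def)

lemma unique_not_several:
  assumes "unique_equilibrium X T E"
  shows "\<not> several_equilibria X T E"
proof
  from assms obtain \<mu> Q where
    "\<And>\<mu>' Q'. equilibrium_pair X T E \<mu>' Q' \<Longrightarrow> same_pair X \<mu>' Q' \<mu> Q"
    unfolding unique_equilibrium_def by blast
  then have "same_pair X \<mu>1 Q1 \<mu>2 Q2"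
    if "equilibrium_pair X T E \<mu>1 Q1" "equilibrium_pair X T E \<mu>2 Q2" for \<mu>1 Q1 \<mu>2 Q2
    using that same_pair_sym same_pair_trans by metis
  moreover assume "several_equilibria X T E"
  ultimately show False
    unfolding several_equilibria_def by blast
qed

lemma spin_law_0: "spin_law 0 = (\<lambda>s. 1 / 2)"
  by (simp add: spin_law_def fun_eq_iff)

lemma subcritical_equilibria:
  assumes "0 \<le> \<beta>" "\<beta> \<le> 1"
  shows "equilibrium_pair spins spin_map (spin_energy \<beta>) (\<lambda>s. 1 / 2) (\<lambda>s t. 1 / 2)"
    and "equilibrium_pair spins spin_map (spin_energy \<beta>) \<mu> Q \<Longrightarrow>
      same_pair spins \<mu> Q (\<lambda>s. 1 / 2) (\<lambda>s t. 1 / 2)"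
proof -
  note max = free_energy_max_subcritical[OF assms]
  have zero: "0 = tanh (\<beta> * 0)" by simp
  show "equilibrium_pair spins spin_map (spin_energy \<beta>) (\<lambda>s. 1 / 2) (\<lambda>s t. 1 / 2)"
    using equilibrium_spin_law[OF zero max] by (simp add: spin_law_0)
  assume "equilibrium_pair spins spin_map (spin_energy \<beta>) \<mu> Q"
  from equilibrium_pair_cases[OF zero max this]
  obtain m where m: "m = tanh (\<beta> * m)" "same_pair spins \<mu> Q (spin_law m) (\<lambda>s. spin_law m)" .
  have "\<not> 0 < m" "\<not> 0 < - m"
    using tanh_mult_less_id[OF assms(2), of m] tanh_mult_less_id[OF assms(2), of "- m"] m(1) by auto
  then have "m = 0" by linarith
  then show "same_pair spins \<mu> Q (\<lambda>s. 1 / 2) (\<lambda>s t. 1 / 2)"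
    using m(2) by (simp add: spin_law_0)
qed

lemma supercritical_equilibria:
  assumes \<beta>: "1 < \<beta>"
  shows "\<sigma> \<in> {-1, 1} \<Longrightarrow> equilibrium_pair spins spin_map (spin_energy \<beta>)
      (spin_law (real_of_int \<sigma> * magnetization \<beta>)) (\<lambda>s. spin_law (real_of_int \<sigma> * magnetization \<beta>))"
    and "equilibrium_pair spins spin_map (spin_energy \<beta>) \<mu> Q \<Longrightarrow>
      \<exists>\<sigma>\<in>{-1, 1}. same_pair spins \<mu> Q (spin_law (real_of_int \<sigma> * magnetization \<beta>))
        (\<lambda>s. spin_law (real_of_int \<sigma> * magnetization \<beta>))"
proof -
  note max = free_energy_max_supercritical[OF \<beta>]
  note fixed = magnetization_eq[OF \<beta>]
  show "equilibrium_pair spins spin_map (spin_energy \<beta>)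
      (spin_law (real_of_int \<sigma> * magnetization \<beta>)) (\<lambda>s. spin_law (real_of_int \<sigma> * magnetization \<beta>))"
    if "\<sigma> \<in> {-1, 1}"
  proof (rule equilibrium_spin_law)
    show "real_of_int \<sigma> * magnetization \<beta> = tanh (\<beta> * (real_of_int \<sigma> * magnetization \<beta>))"
      using that by (auto simp: fixed[symmetric])
    show "free_energy \<beta> x \<le> free_energy \<beta> (real_of_int \<sigma> * magnetization \<beta>)" for x
      using that max[of x] free_energy_abs[of \<beta> "- magnetization \<beta>"] magnetization_pos[OF \<beta>] by auto
  qed
  assume "equilibrium_pair spins spin_map (spin_energy \<beta>) \<mu> Q"
  from equilibrium_pair_cases[OF fixed max this]
  obtain m where m: "m = tanh (\<beta> * m)" "free_energy \<beta> m = free_energy \<beta> (magnetization \<beta>)"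
    "same_pair spins \<mu> Q (spin_law m) (\<lambda>s. spin_law m)" .
  have "m \<noteq> 0"
    using m(2) free_energy_0_less_magnetization[OF \<beta>] by auto
  with mean_field_solutions[OF \<beta> m(1)] have "m = - magnetization \<beta> \<or> m = magnetization \<beta>"
    by simp
  with m(3) show "\<exists>\<sigma>\<in>{-1, 1}. same_pair spins \<mu> Q (spin_law (real_of_int \<sigma> * magnetization \<beta>))
        (\<lambda>s. spin_law (real_of_int \<sigma> * magnetization \<beta>))"
    by auto
qed

lemma same_pair_spin_law_iff:
  "same_pair spins (spin_law m) (\<lambda>s. spin_law m) (spin_law m') (\<lambda>s. spin_law m') \<longleftrightarrow> m = m'"
  by (auto simp: same_pair_def spins_def spin_law_def)

lemma flip_invariant_spin_law:
  assumes "same_pair spins \<mu> Q (spin_law m) (\<lambda>s. spin_law m)"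
  shows "flip_invariant \<mu> Q \<longleftrightarrow> m = 0"
proof
  have mu: "\<mu> s = spin_law m s" if "s \<in> spins" for s
    using assms that by (simp add: same_pair_def)
  have Q: "Q s t = spin_law m t" if "s \<in> spins" "t \<in> spins" "\<mu> s \<noteq> 0" for s t
    using assms that by (simp add: same_pair_def)
  have flip: "- s \<in> spins" if "s \<in> spins" for s
    using that by (auto simp: spins_def)
  show "m = 0" if "flip_invariant \<mu> Q"
  proof -
    have "\<mu> (- s) = \<mu> s" if "s \<in> spins" for s
      using \<open>flip_invariant \<mu> Q\<close> that unfolding flip_invariant_def same_pair_def by blast
    from this[of 1] have "\<mu> (-1) = \<mu> 1"
      by (simp add: spins_def)
    then show ?thesis
      using mu[of 1] mu[of "-1"] by (simp add: spins_def spin_law_def)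
  qed
  show "flip_invariant \<mu> Q" if "m = 0"
  proof -
    have mu0: "\<mu> s = 1 / 2" if "s \<in> spins" for s
      using mu[OF that] \<open>m = 0\<close> by (simp add: spin_law_0)
    have Q0: "Q s t = 1 / 2" if "s \<in> spins" "t \<in> spins" for s t
      using Q[OF that] mu0[OF that(1)] \<open>m = 0\<close> by (simp add: spin_law_0)
    show ?thesis
      unfolding flip_invariant_def same_pair_def by (simp add: mu0 Q0 flip)
  qed
qed

lemma flip_invariant_equilibrium_iff:
  assumes "0 \<le> \<beta>" "equilibrium_pair spins spin_map (spin_energy \<beta>) \<mu> Q"
  shows "flip_invariant \<mu> Q \<longleftrightarrow> \<beta> \<le> 1"
proof (cases "\<beta> \<le> 1")
  case True
  then show ?thesis
    using subcritical_equilibria(2)[OF assms(1) True assms(2)] flip_invariant_spin_law[of \<mu> Q 0]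
    by (simp add: spin_law_0)
next
  case False
  then have \<beta>: "1 < \<beta>" by simp
  from supercritical_equilibria(2)[OF \<beta> assms(2)]
  obtain \<sigma> where \<sigma>: "\<sigma> \<in> {-1, 1}" and same: "same_pair spins \<mu> Q
    (spin_law (real_of_int \<sigma> * magnetization \<beta>)) (\<lambda>s. spin_law (real_of_int \<sigma> * magnetization \<beta>))"
    by blast
  have "real_of_int \<sigma> * magnetization \<beta> \<noteq> 0"
    using \<sigma> magnetization_pos[OF \<beta>] by auto
  with flip_invariant_spin_law[OF same] False show ?thesis by simp
qed

lemma unique_equilibrium_subcritical:
  assumes "0 \<le> \<beta>" "\<beta> \<le> 1"
  shows "unique_equilibrium spins spin_map (spin_energy \<beta>)"
  unfolding unique_equilibrium_def using subcritical_equilibria[OF assms] by blast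

lemma several_equilibria_supercritical:
  assumes \<beta>: "1 < \<beta>"
  shows "several_equilibria spins spin_map (spin_energy \<beta>)"
proof -
  have "\<not> same_pair spins (spin_law (- magnetization \<beta>)) (\<lambda>s. spin_law (- magnetization \<beta>))
      (spin_law (magnetization \<beta>)) (\<lambda>s. spin_law (magnetization \<beta>))"
    using magnetization_pos[OF \<beta>] by (simp add: same_pair_spin_law_iff)
  then show ?thesis
    unfolding several_equilibria_def
    using supercritical_equilibria(1)[OF \<beta>, of "-1"] supercritical_equilibria(1)[OF \<beta>, of 1]
    by auto
qed

lemma critical_inverse_temperature_spins:
  "critical_inverse_temperature spins spin_map spin_energy b \<longleftrightarrow> b = 1"
proof
  assume b: "critical_inverse_temperature spins spin_map spin_energy b"
  \<comment> \<open>At the midpoint of \<open>b\<close> and \<open>1\<close> uniqueness and non-uniqueness would hold together.\<close>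
  show "b = 1"
  proof (cases b "1::real" rule: linorder_cases)
    case less
    have "several_equilibria spins spin_map (spin_energy ((b + 1) / 2))"
      using b less by (simp add: critical_inverse_temperature_def)
    moreover have "unique_equilibrium spins spin_map (spin_energy ((b + 1) / 2))"
      using b less by (intro unique_equilibrium_subcritical)
        (simp_all add: critical_inverse_temperature_def)
    ultimately show ?thesis using unique_not_several by blast
  next
    case greater
    have "unique_equilibrium spins spin_map (spin_energy ((b + 1) / 2))"
      using b greater by (simp add: critical_inverse_temperature_def)
    moreover have "several_equilibria spins spin_map (spin_energy ((b + 1) / 2))"
      using greater by (intro several_equilibria_supercritical) simp
    ultimately show ?thesis using unique_not_several by blast
  qed
qed (simp add: critical_inverse_temperature_def unique_equilibrium_subcritical
    several_equilibria_supercritical)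

theorem proposition7p2:
  "(\<forall>b. critical_inverse_temperature spins spin_map spin_energy b \<longleftrightarrow> b = 1) \<and>
   (\<forall>\<beta>. 0 \<le> \<beta> \<and> \<beta> \<le> 1 \<longrightarrow>
      equilibrium_pair spins spin_map (spin_energy \<beta>) (\<lambda>s. 1 / 2) (\<lambda>s t. 1 / 2) \<and>
      (\<forall>\<mu> Q. equilibrium_pair spins spin_map (spin_energy \<beta>) \<mu> Q \<longrightarrow>
         same_pair spins \<mu> Q (\<lambda>s. 1 / 2) (\<lambda>s t. 1 / 2))) \<and>
   (\<forall>\<beta>>1.
      (\<exists>!m. 0 < m \<and> m = tanh (\<beta> * m)) \<and>
      0 < magnetization \<beta> \<and> magnetization \<beta> < 1 \<and>
      (let \<mu> = (\<lambda>\<sigma> s. spin_law (real_of_int \<sigma> * magnetization \<beta>) s);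
           Q = (\<lambda>\<sigma> s t. spin_law (real_of_int \<sigma> * magnetization \<beta>) t)
       in (\<forall>\<sigma>\<in>{-1, 1}.
             equilibrium_pair spins spin_map (spin_energy \<beta>) (\<mu> \<sigma>) (Q \<sigma>) \<and>
             (\<forall>s\<in>spins. \<forall>t\<in>spins. two_coord spins (\<mu> \<sigma>) (Q \<sigma>) (s, t) =
                spin_law (real_of_int \<sigma> * magnetization \<beta>) s *
                spin_law (real_of_int \<sigma> * magnetization \<beta>) t)) \<and>
          \<not> same_pair spins (\<mu> (-1)) (Q (-1)) (\<mu> 1) (Q 1) \<and>
          (\<forall>\<nu> R. equilibrium_pair spins spin_map (spin_energy \<beta>) \<nu> R \<longrightarrow>
             (\<exists>\<sigma>\<in>{-1, 1}. same_pair spins \<nu> R (\<mu> \<sigma>) (Q \<sigma>))))) \<and>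
   (\<forall>\<beta>\<ge>0.
      convergent (finite_pressure spins spin_map (spin_energy \<beta>)) \<and>
      nonlinear_pressure spins spin_map (spin_energy \<beta>) =
        (if \<beta> \<le> 1 then ln 2
         else ln (2 * cosh (\<beta> * magnetization \<beta>)) - \<beta> / 2 * (magnetization \<beta>)\<^sup>2)) \<and>
   (magnetization \<longlongrightarrow> 0) (at_right 1) \<and>
   (\<forall>\<beta> \<mu> Q. 0 \<le> \<beta> \<and> equilibrium_pair spins spin_map (spin_energy \<beta>) \<mu> Q \<longrightarrow>
      (flip_invariant \<mu> Q \<longleftrightarrow> \<beta> \<le> 1))"
proof (intro conjI allI impI)
  fix b
  show "critical_inverse_temperature spins spin_map spin_energy b \<longleftrightarrow> b = 1"
    by (rule critical_inverse_temperature_spins)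
next
  fix \<beta> :: real assume "0 \<le> \<beta> \<and> \<beta> \<le> 1"
  then show "equilibrium_pair spins spin_map (spin_energy \<beta>) (\<lambda>s. 1 / 2) (\<lambda>s t. 1 / 2)"
    using subcritical_equilibria(1) by simp
next
  fix \<beta> :: real and \<mu> Q
  assume "0 \<le> \<beta> \<and> \<beta> \<le> 1" "equilibrium_pair spins spin_map (spin_energy \<beta>) \<mu> Q"
  then show "same_pair spins \<mu> Q (\<lambda>s. 1 / 2) (\<lambda>s t. 1 / 2)"
    using subcritical_equilibria(2) by blast
next
  fix \<beta> :: real assume \<beta>: "1 < \<beta>"
  show "\<exists>!m. 0 < m \<and> m = tanh (\<beta> * m)" "0 < magnetization \<beta>" "magnetization \<beta> < 1"
    using mean_field_ex1[OF \<beta>] magnetization_pos[OF \<beta>] magnetization_less_1[OF \<beta>] by blast+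
  have "two_coord spins (spin_law m) (\<lambda>s. spin_law m) (s, t) = spin_law m s * spin_law m t"
    if "s \<in> spins" "t \<in> spins" for m s t
    using that by (simp add: two_coord_def)
  moreover have "- magnetization \<beta> \<noteq> magnetization \<beta>"
    using magnetization_pos[OF \<beta>] by simp
  ultimately show "let \<mu> = (\<lambda>\<sigma> s. spin_law (real_of_int \<sigma> * magnetization \<beta>) s);
           Q = (\<lambda>\<sigma> s t. spin_law (real_of_int \<sigma> * magnetization \<beta>) t)
       in (\<forall>\<sigma>\<in>{-1, 1}.
             equilibrium_pair spins spin_map (spin_energy \<beta>) (\<mu> \<sigma>) (Q \<sigma>) \<and>
             (\<forall>s\<in>spins. \<forall>t\<in>spins. two_coord spins (\<mu> \<sigma>) (Q \<sigma>) (s, t) =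
                spin_law (real_of_int \<sigma> * magnetization \<beta>) s *
                spin_law (real_of_int \<sigma> * magnetization \<beta>) t)) \<and>
          \<not> same_pair spins (\<mu> (-1)) (Q (-1)) (\<mu> 1) (Q 1) \<and>
          (\<forall>\<nu> R. equilibrium_pair spins spin_map (spin_energy \<beta>) \<nu> R \<longrightarrow>
             (\<exists>\<sigma>\<in>{-1, 1}. same_pair spins \<nu> R (\<mu> \<sigma>) (Q \<sigma>)))"
    using supercritical_equilibria[OF \<beta>] unfolding Let_def same_pair_spin_law_iff by simp
next
  fix \<beta> :: real assume "0 \<le> \<beta>"
  then show "convergent (finite_pressure spins spin_map (spin_energy \<beta>))"
    and "nonlinear_pressure spins spin_map (spin_energy \<beta>) =
        (if \<beta> \<le> 1 then ln 2
         else ln (2 * cosh (\<beta> * magnetization \<beta>)) - \<beta> / 2 * (magnetization \<beta>)\<^sup>2)"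
    using convergent_finite_pressure by blast+
next
  show "(magnetization \<longlongrightarrow> 0) (at_right 1)"
    by (rule magnetization_tendsto_0)
next
  fix \<beta> :: real and \<mu> Q
  assume "0 \<le> \<beta> \<and> equilibrium_pair spins spin_map (spin_energy \<beta>) \<mu> Q"
  then show "flip_invariant \<mu> Q \<longleftrightarrow> \<beta> \<le> 1"
    using flip_invariant_equilibrium_iff by blast
qed

end
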